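(* Let $\Omega\subseteq\mathbb{R}^n$ be open and let $u\in C^1(\Omega,\mathbb{R}^N)$ be such that $|Du|$ has no local minima in $\Omega$. For each nonempty open $\Omega'\Subset\Omega$ put $$\Omega'(u):=\Big\{x\in\overline{\Omega'}\ :\ |Du(x)|=\|Du\|_{L^\infty(\Omega')}\Big\}.$$ (1) Let $\mathcal{A}^{\top,\infty}_{\Omega'}(u)$ be the set consisting of all constant maps $\mathbb{R}^n\to\mathbb{R}^N$ together with all affine maps $A:\mathbb{R}^n\to\mathbb{R}^N$ for which there exist $\xi\in\mathbb{R}^N$, $x\in\Omega'(u)$, a diffuse hessian $\mathcal{D}^2u\in\mathscr{Y}\big(\Omega,\overline{\mathbb{R}}^{Nn^2}_s\big)$ of $u$ and $\mathbf{X}_x\in\mathrm{supp}_*\big(\mathcal{D}^2u(x)\big)$ such that $DA\equiv\xi\otimes\big(\mathbf{X}_x:Du(x)\big)$. Then $Du\otimes Du:D^2u=0$ on $\Omega$ in the $\mathcal{D}$-sense if and only if for all nonempty open $\Omega'\Subset\Omega$ and all $A\in\mathcal{A}^{\top,\infty}_{\Omega'}(u)$, $$\|Du\|_{L^\infty(\Omega')}\leq\|Du+DA\|_{L^\infty(\Omega')}.$$ (2) Let $\mathcal{A}^{\bot,\infty}_{\Omega'}(u)$ be the set consisting of all constant maps $\mathbb{R}^n\to\mathbb{R}^N$ together with all affine maps $A:\mathbb{R}^n\to\mathbb{R}^N$ for which there exist $x\in\Omega'(u)$, a diffuse hessian $\mathcal{D}^2u\in\mathscr{Y}\big(\Omega,\overline{\mathbb{R}}^{Nn^2}_s\big)$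 of $u$ and $\mathbf{X}_x\in\mathrm{supp}_*\big(\mathcal{D}^2u(x)\big)$ such that $A(x)\in R\big(Du(x)\big)^\bot$ and $DA\in\mathscr{L}^{\mathbf{X}_x}\big(A(x)\big)$, where for $a\in\mathbb{R}^N$ $$\mathscr{L}^{\mathbf{X}_x}(a):=\begin{cases}\big\{X\in\mathbb{R}^{Nn}\ :\ Du(x):X=-(a\otimes I):\mathbf{X}_x\big\},&\text{if }Du(x)\neq0,\\ \{0\},&\text{if }Du(x)=0.\end{cases}$$ Then $|Du|^2[Du]^\bot\Delta u=0$ on $\Omega$ in the $\mathcal{D}$-sense if and only if for all nonempty open $\Omega'\Subset\Omega$ and all $A\in\mathcal{A}^{\bot,\infty}_{\Omega'}(u)$, $$\|Du\|_{L^\infty(\Omega')}\leq\|Du+DA\|_{L^\infty(\Omega')}.$$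
   Context: Notation. $\mathbb{R}^{Nn}$ is the space of $N\times n$ matrices $(P_{\alpha i})$ with Euclidean norm $|\cdot|$ and inner product $P:Q=\sum_{\alpha,i}P_{\alpha i}Q_{\alpha i}$; $Du=(D_iu_\alpha)$. $\mathbb{R}^{Nn^2}_s$ is the space of tensors $\mathbf{X}=(\mathbf{X}_{\alpha ij})$, $1\le\alpha\le N$, $1\le i,j\le n$, symmetric in $i,j$. $R(P)\subseteq\mathbb{R}^N$ is the range of $P$, and $[P]^\bot$ is the orthogonal projection of $\mathbb{R}^N$ onto $R(P)^\bot$. For $P\in\mathbb{R}^{Nn}$, $\mathbf{X}\in\mathbb{R}^{Nn^2}_s$, $a,\xi\in\mathbb{R}^N$: $(P\otimes P:\mathbf{X})_\alpha=\sum_{\beta,i,j}P_{\alpha i}P_{\beta j}\mathbf{X}_{\beta ij}$; $(\mathbf{X}:P)_i=\sum_{\beta,j}\mathbf{X}_{\beta ji}P_{\beta j}$, so $\mathbf{X}:P\in\mathbb{R}^n$; $(\xi\otimes v)_{\alpha i}=\xi_\alpha v_i$ for $v\in\mathbb{R}^n$; $(a\otimes I):\mathbf{X}=\sum_{\alpha,i}a_\alpha\mathbf{X}_{\alpha ii}$; $\big(([P]^\bot\otimes I):\mathbf{X}\big)_\alpha=\sum_{\beta,i}[P]^\bot_{\alpha\beta}\mathbf{X}_{\beta ii}$. $\Omega'\Subset\Omega$ means that $\overline{\Omega'}$ is compact and contained in $\Omega$; $\|Du\|_{L^\infty(\Omega')}=\operatorname{ess\,sup}_{\Omega'}|Du|$.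 Young measures. $\overline{\mathbb{R}}^{Nn^2}_s=\mathbb{R}^{Nn^2}_s\cup\{\infty\}$ is the one-point compactification. $\mathscr{Y}(\Omega,\overline{\mathbb{R}}^{Nn^2}_s)$ is the set of (a.e.-equivalence classes of) maps $\vartheta$ from $\Omega$ to the Borel probability measures on $\overline{\mathbb{R}}^{Nn^2}_s$ such that $x\mapsto[\vartheta(x)](\mathcal{U})$ is Lebesgue measurable for every Borel $\mathcal{U}$. It carries the weak* topology, in which $\vartheta^k\to\vartheta$ means $$\int_\Omega\int\Phi(x,\mathbf{X})\,d[\vartheta^k(x)](\mathbf{X})\,dx\to\int_\Omega\int\Phi(x,\mathbf{X})\,d[\vartheta(x)](\mathbf{X})\,dx$$ for all $\Phi\in L^1\big(\Omega,C^0(\overline{\mathbb{R}}^{Nn^2}_s)\big)$; every sequence in this set has a weakly* convergent subsequence. A measurable $U:\Omega\to\mathbb{R}^{Nn^2}_s$ is identified with the Young measure $\delta_U:x\mapsto\delta_{U(x)}$. Diffuse hessians. For $h\ne0$, $D^{1,h}_iv(x)=\frac{v(x+he^i)-v(x)}{h}$ for $x\in\Omega$ ($v$ extended by zero outside $\Omega$), and $D^{1,h}v=(D^{1,h}_1v,\dots,D^{1,h}_nv)$. The array $D^{1,h}Du(x)$ is regarded as an element of $\mathbb{R}^{Nn^2}_s$ (by symmetrisation in the two lower indices). The diffuse hessians $\mathcal{D}^2u$ of $u$ are all the subsequential weak* limits in $\mathscr{Y}(\Omega,\overline{\mathbb{R}}^{Nn^2}_s)$ of $\delta_{D^{1,h_\nu}Du}$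 along sequences $h_\nu\to0$, $h_\nu\neq 0$. The reduced support of a probability $\vartheta$ on $\overline{\mathbb{R}}^{Nn^2}_s$ is $\mathrm{supp}_*(\vartheta)=\mathrm{supp}(\vartheta)\setminus\{\infty\}$. $\mathcal{D}$-solutions. For $F:\mathbb{R}^{Nn}\times\mathbb{R}^{Nn^2}_s\to\mathbb{R}^N$ Borel in the first and continuous in the second argument, $u$ solves $F(Du,D^2u)=0$ on $\Omega$ in the $\mathcal{D}$-sense when for every diffuse hessian $\mathcal{D}^2u$ of $u$, for a.e. $x\in\Omega$, $F(Du(x),\mathbf{X})=0$ for all $\mathbf{X}\in\mathrm{supp}_*(\mathcal{D}^2u(x))$ (vacuously true when this set is empty). The system $Du\otimes Du:D^2u=0$ corresponds to $F(P,\mathbf{X})=P\otimes P:\mathbf{X}$ and $|Du|^2[Du]^\bot\Delta u=0$ to $F(P,\mathbf{X})=|P|^2([P]^\bot\otimes I):\mathbf{X}$. Convention on representatives. For each diffuse hessian a representative defined at every $x\in\Omega$ is fixed once and for all (set equal to $\delta_{\{0\}}$ at points where it was not defined), modified on a Lebesgue nullset so that, for each of the two functions $F$ just listed, if "$F(Du(x),\mathbf{X})=0$ for all $\mathbf{X}\in\mathrm{supp}_*(\mathcal{D}^2u(x))$" holds for a.e. $x\in\Omega$, then it holds for every $x\in\Omega$. The values $\mathcal{D}^2u(x)$ in the definitions of the sets of affine maps refer to these fixed representatives. *)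

theory Defs
  imports "HOL-Probability.Probability"
begin

text \<open>
  An $N \times n$ matrix is an element of \<^typ>\<open>real^'n^'N\<close> and an array
  $(\mathbf{X}_{\alpha ij})$ is an element of \<^typ>\<open>real^'n^'n^'N\<close>, with entries
  \<open>X $ \<alpha> $ i $ j\<close>. On both types \<^const>\<open>norm\<close> and \<^const>\<open>inner\<close> are the Euclidean ones
  of the entries, so \<open>P \<bullet> Q\<close> is $P : Q$. The gradient $Du(x)$ is \<open>jacobian u (at x)\<close>.
\<close>

section \<open>Tensor algebra\<close>

definition sym_tensors :: "(real^'n^'n^'N) set" where
  "sym_tensors = {X. \<forall>\<alpha> i j. X $ \<alpha> $ i $ j = X $ \<alpha> $ j $ i}"

definition tangential_op :: "real^'n^'N \<Rightarrow> real^'n^'n^'N \<Rightarrow> real^'N" where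
  "tangential_op P X = (\<chi> \<alpha>. \<Sum>\<beta>\<in>UNIV. \<Sum>i\<in>UNIV. \<Sum>j\<in>UNIV. P $ \<alpha> $ i * P $ \<beta> $ j * X $ \<beta> $ i $ j)"

definition contract :: "real^'n^'n^'N \<Rightarrow> real^'n^'N \<Rightarrow> real^'n" where
  "contract X P = (\<chi> i. \<Sum>\<beta>\<in>UNIV. \<Sum>j\<in>UNIV. X $ \<beta> $ j $ i * P $ \<beta> $ j)"

definition outer :: "real^'N \<Rightarrow> real^'n \<Rightarrow> real^'n^'N" where
  "outer \<xi> v = (\<chi> \<alpha> i. \<xi> $ \<alpha> * v $ i)"

definition trace_against :: "real^'N \<Rightarrow> real^'n^'n^'N \<Rightarrow> real" where
  "trace_against a X = (\<Sum>\<alpha>\<in>UNIV. \<Sum>i\<in>UNIV. a $ \<alpha> * X $ \<alpha> $ i $ i)"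

definition mat_range :: "real^'n^'N \<Rightarrow> (real^'N) set" where
  "mat_range P = range (\<lambda>v. P *v v)"

definition orth_proj :: "(real^'N) set \<Rightarrow> real^'N \<Rightarrow> real^'N" where
  "orth_proj W y = (THE z. z \<in> W \<and> (\<forall>w\<in>W. orthogonal (y - z) w))"

definition perp_proj :: "real^'n^'N \<Rightarrow> real^'N^'N" where
  "perp_proj P = matrix (orth_proj (orthogonal_comp (mat_range P)))"

definition normal_op :: "real^'n^'N \<Rightarrow> real^'n^'n^'N \<Rightarrow> real^'N" where
  "normal_op P X =
     (norm P)\<^sup>2 *\<^sub>R (\<chi> \<alpha>. \<Sum>\<beta>\<in>UNIV. \<Sum>i\<in>UNIV. perp_proj P $ \<alpha> $ \<beta> * X $ \<beta> $ i $ i)"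

lemma orth_proj_props:
  fixes W :: "(real^'N) set"
  assumes "subspace W"
  shows "orth_proj W y \<in> W \<and> (\<forall>w\<in>W. orthogonal (y - orth_proj W y) w)"
  unfolding orth_proj_def
proof (rule theI')
  obtain z e where ze: "z \<in> span W" "\<And>w. w \<in> span W \<Longrightarrow> orthogonal e w" "y = z + e"
    using orthogonal_subspace_decomp_exists[of W y] by blast
  have sp: "span W = W" using assms by (simp add: span_eq_iff)
  show "\<exists>!z. z \<in> W \<and> (\<forall>w\<in>W. orthogonal (y - z) w)"
  proof (rule ex1I[of _ z])
    show "z \<in> W \<and> (\<forall>w\<in>W. orthogonal (y - z) w)" using ze sp by auto
  next
    fix z' assume z': "z' \<in> W \<and> (\<forall>w\<in>W. orthogonal (y - z') w)"
    have d: "z' - z \<in> W" using z' ze sp assms by (simp add: subspace_diff)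
    have "orthogonal e (z' - z)" "orthogonal (y - z') (z' - z)" using d z' ze sp by auto
    then have "(z' - z) \<bullet> (z' - z) = 0"
      using ze(3) by (simp add: orthogonal_def inner_diff_left inner_add_left)
    then show "z' = z" by simp
  qed
qed


section \<open>Young measures into the one-point compactification\<close>

text \<open>The point at infinity is \<^const>\<open>None\<close>.\<close>

abbreviation ctensors :: "(real^'n^'n^'N) option topology" where
  "ctensors \<equiv> Alexandroff_compactification (top_of_set sym_tensors)"

definition borel_ctensors :: "(real^'n^'n^'N) option measure" where
  "borel_ctensors = sigma (topspace ctensors) {U. openin ctensors U}"

definition young_measure ::
    "(real^'n) set \<Rightarrow> (real^'n \<Rightarrow> (real^'n^'n^'N) option measure) \<Rightarrow> bool" where
  "young_measure \<Omega> \<theta> \<longleftrightarrow>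
     (\<forall>x\<in>\<Omega>. sets (\<theta> x) = sets borel_ctensors \<and> prob_space (\<theta> x)) \<and>
     (\<forall>U\<in>sets borel_ctensors. (\<lambda>x. measure (\<theta> x) U) \<in> borel_measurable (lebesgue_on \<Omega>))"

text \<open>
  The Bochner space $L^1(\Omega, C^0)$ with $C^0$ normed by the supremum norm: almost everywhere
  limits of simple functions, with integrable norm.
\<close>

definition bochner_L1_C0 ::
    "(real^'n) set \<Rightarrow> (real^'n \<Rightarrow> (real^'n^'n^'N) option \<Rightarrow> real) \<Rightarrow> bool" where
  "bochner_L1_C0 \<Omega> \<Phi> \<longleftrightarrow>
     (\<forall>x\<in>\<Omega>. continuous_map ctensors euclideanreal (\<Phi> x)) \<and>
     (\<exists>s. (\<forall>k. simple_function (lebesgue_on \<Omega>) (s k) \<and>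
               (\<forall>x\<in>\<Omega>. continuous_map ctensors euclideanreal (s k x))) \<and>
          (AE x in lebesgue_on \<Omega>.
             uniform_limit (topspace ctensors) (\<lambda>k. s k x) (\<Phi> x) sequentially)) \<and>
     integrable (lebesgue_on \<Omega>) (\<lambda>x. SUP p\<in>topspace ctensors. \<bar>\<Phi> x p\<bar>)"

definition weak_star_lim ::
    "(real^'n) set \<Rightarrow> (nat \<Rightarrow> real^'n \<Rightarrow> (real^'n^'n^'N) option measure)
       \<Rightarrow> (real^'n \<Rightarrow> (real^'n^'n^'N) option measure) \<Rightarrow> bool" where
  "weak_star_lim \<Omega> \<theta>s \<theta> \<longleftrightarrow>
     (\<forall>\<Phi>. bochner_L1_C0 \<Omega> \<Phi> \<longrightarrow>
        (\<lambda>k. LINT x|lebesgue_on \<Omega>. LINT p|\<theta>s k x. \<Phi> x p)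
          \<longlonglongrightarrow> (LINT x|lebesgue_on \<Omega>. LINT p|\<theta> x. \<Phi> x p))"

definition delta_young ::
    "(real^'n \<Rightarrow> real^'n^'n^'N) \<Rightarrow> real^'n \<Rightarrow> (real^'n^'n^'N) option measure" where
  "delta_young V x = return borel_ctensors (Some (V x))"

text \<open>The reduced support, as a set of tensors: the point \<^const>\<open>None\<close> is left out.\<close>

definition supp_star :: "(real^'n^'n^'N) option measure \<Rightarrow> (real^'n^'n^'N) set" where
  "supp_star \<mu> =
     {X \<in> sym_tensors. \<forall>U. openin ctensors U \<and> Some X \<in> U \<longrightarrow> emeasure \<mu> U > 0}"


section \<open>Diffuse hessians and \<open>\<D>\<close>-solutions\<close>

definition C1_on :: "(real^'n) set \<Rightarrow> (real^'n \<Rightarrow> real^'N) \<Rightarrow> bool" where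
  "C1_on \<Omega> u \<longleftrightarrow>
     (\<forall>x\<in>\<Omega>. u differentiable (at x)) \<and> continuous_on \<Omega> (\<lambda>x. jacobian u (at x))"

definition diff_quot ::
    "(real^'n) set \<Rightarrow> real \<Rightarrow> (real^'n \<Rightarrow> 'b::real_vector) \<Rightarrow> 'n \<Rightarrow> real^'n \<Rightarrow> 'b" where
  "diff_quot \<Omega> h v i x =
     (let v0 = (\<lambda>y. if y \<in> \<Omega> then v y else 0)
      in (1 / h) *\<^sub>R (v0 (x + h *\<^sub>R axis i 1) - v0 x))"

definition diff_hessian ::
    "(real^'n) set \<Rightarrow> real \<Rightarrow> (real^'n \<Rightarrow> real^'N) \<Rightarrow> real^'n \<Rightarrow> real^'n^'n^'N" where
  "diff_hessian \<Omega> h u x =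
     (let H = (\<lambda>\<alpha> i j. diff_quot \<Omega> h (\<lambda>y. jacobian u (at y)) i x $ \<alpha> $ j)
      in \<chi> \<alpha> i j. (H \<alpha> i j + H \<alpha> j i) / 2)"

definition diffuse_hessian ::
    "(real^'n) set \<Rightarrow> (real^'n \<Rightarrow> real^'N)
       \<Rightarrow> (real^'n \<Rightarrow> (real^'n^'n^'N) option measure) \<Rightarrow> bool" where
  "diffuse_hessian \<Omega> u \<theta> \<longleftrightarrow>
     young_measure \<Omega> \<theta> \<and>
     (\<exists>h::nat \<Rightarrow> real. \<exists>r::nat \<Rightarrow> nat.
        (\<forall>\<nu>. h \<nu> \<noteq> 0) \<and> h \<longlonglongrightarrow> 0 \<and> strict_mono r \<and>
        weak_star_lim \<Omega> (\<lambda>k. delta_young (diff_hessian \<Omega> (h (r k)) u)) \<theta>)"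

definition solves_at ::
    "(real^'n^'N \<Rightarrow> real^'n^'n^'N \<Rightarrow> real^'N) \<Rightarrow> (real^'n \<Rightarrow> real^'N)
       \<Rightarrow> (real^'n \<Rightarrow> (real^'n^'n^'N) option measure) \<Rightarrow> real^'n \<Rightarrow> bool" where
  "solves_at F u \<theta> x \<longleftrightarrow> (\<forall>X\<in>supp_star (\<theta> x). F (jacobian u (at x)) X = 0)"

definition D_solution ::
    "(real^'n^'N \<Rightarrow> real^'n^'n^'N \<Rightarrow> real^'N) \<Rightarrow> (real^'n) set \<Rightarrow> (real^'n \<Rightarrow> real^'N) \<Rightarrow> bool" where
  "D_solution F \<Omega> u \<longleftrightarrow>
     (\<forall>\<theta>. diffuse_hessian \<Omega> u \<theta> \<longrightarrow> (AE x in lebesgue_on \<Omega>. solves_at F u \<theta> x))"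

text \<open>
  Diffuse hessians are almost everywhere equivalence classes. A choice of representatives is a
  map \<open>rep\<close> sending each diffuse hessian to a representative of its class, depending only on
  the class, such that each of the two systems holds everywhere on \<open>\<Omega>\<close> for the representative
  as soon as it holds almost everywhere.
\<close>

definition representative_choice ::
    "(real^'n) set \<Rightarrow> (real^'n \<Rightarrow> real^'N) \<Rightarrow>
     ((real^'n \<Rightarrow> (real^'n^'n^'N) option measure) \<Rightarrow>
      (real^'n \<Rightarrow> (real^'n^'n^'N) option measure)) \<Rightarrow> bool" where
  "representative_choice \<Omega> u rep \<longleftrightarrow>
     (\<forall>\<theta>. diffuse_hessian \<Omega> u \<theta> \<longrightarrow>
        young_measure \<Omega> (rep \<theta>) \<and>
        (AE x in lebesgue_on \<Omega>. rep \<theta> x = \<theta> x) \<and>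
        (\<forall>F\<in>{tangential_op, normal_op}.
           (AE x in lebesgue_on \<Omega>. solves_at F u (rep \<theta>) x) \<longrightarrow>
           (\<forall>x\<in>\<Omega>. solves_at F u (rep \<theta>) x))) \<and>
     (\<forall>\<theta> \<theta>'. diffuse_hessian \<Omega> u \<theta> \<and> diffuse_hessian \<Omega> u \<theta>' \<and>
        (AE x in lebesgue_on \<Omega>. \<theta> x = \<theta>' x) \<longrightarrow>
        (\<forall>x\<in>\<Omega>. rep \<theta> x = rep \<theta>' x))"

lemma openin_ctensors_subset:
  "{U. openin (ctensors :: (real^'n^'n^'N) option topology) U} \<subseteq> Pow (topspace ctensors)"
  using openin_subset by blast

lemma space_borel_ctensors: "space borel_ctensors = topspace ctensors"
  by (simp only: borel_ctensors_def space_measure_of[OF openin_ctensors_subset])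

lemma openin_sets_borel_ctensors: "openin ctensors U \<Longrightarrow> U \<in> sets borel_ctensors"
  by (simp only: borel_ctensors_def sets_measure_of[OF openin_ctensors_subset])
     (simp add: sigma_sets.Basic)

lemma supp_star_return_0:
  "supp_star (return borel_ctensors (Some (0::real^'n^'n^'N))) \<subseteq> {0}"
proof
  fix X :: "real^'n^'n^'N"
  assume X: "X \<in> supp_star (return borel_ctensors (Some 0))"
  show "X \<in> {0}"
  proof (rule ccontr)
    assume "X \<notin> {0}"
    define U :: "(real^'n^'n^'N) option set" where "U = Some ` (sym_tensors - {0})"
    have "sym_tensors - {0} = (sym_tensors :: (real^'n^'n^'N) set) \<inter> - {0}" by auto
    then have U: "openin ctensors U"
      unfolding U_def openin_Alexandroff_compactification_image_Some
      by (metis open_Compl closed_singleton openin_open_Int)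
    have "U \<in> sets borel_ctensors"
      using U by (rule openin_sets_borel_ctensors)
    then have "emeasure (return borel_ctensors (Some 0)) U = 0"
      by (auto simp: emeasure_return U_def indicator_def)
    moreover have "Some X \<in> U"
      using X \<open>X \<notin> {0}\<close> by (auto simp: U_def supp_star_def)
    ultimately show False
      using X U by (auto simp: supp_star_def)
  qed
qed

text \<open>The convention on representatives is satisfiable.\<close>

lemma representative_choice_exists:
  fixes u :: "real^'n \<Rightarrow> real^'N"
  assumes "open \<Omega>"
  shows "\<exists>rep. representative_choice \<Omega> u rep"
proof -
  define Fs :: "(real^'n^'N \<Rightarrow> real^'n^'n^'N \<Rightarrow> real^'N) set" where "Fs = {tangential_op, normal_op}"
  define D :: "(real^'n^'n^'N) option measure" where "D = return borel_ctensors (Some 0)"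
  define c where "c = (\<lambda>\<theta>. SOME \<theta>'. diffuse_hessian \<Omega> u \<theta>' \<and> (AE x in lebesgue_on \<Omega>. \<theta> x = \<theta>' x))"
  define bad where "bad = (\<lambda>\<theta> x. \<exists>F\<in>Fs. (AE y in lebesgue_on \<Omega>. solves_at F u \<theta> y) \<and> \<not> solves_at F u \<theta> x)"
  define rep where "rep = (\<lambda>\<theta> x. if bad (c \<theta>) x then D else c \<theta> x)"
  have leb: "\<Omega> \<in> sets lebesgue" using assms by simp
  have c: "diffuse_hessian \<Omega> u (c \<theta>) \<and> (AE x in lebesgue_on \<Omega>. \<theta> x = c \<theta> x)"
    if "diffuse_hessian \<Omega> u \<theta>" for \<theta>
    unfolding c_def by (rule someI[of _ \<theta>]) (use that in simp)
  have D0: "solves_at F u \<theta> x" if "F \<in> Fs" "\<theta> x = D" for F \<theta> x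
  proof -
    have "F P 0 = 0" for P
      using that(1) by (auto simp: Fs_def tangential_op_def normal_op_def vec_eq_iff)
    then show ?thesis
      using supp_star_return_0 that(2) unfolding solves_at_def D_def by fastforce
  qed
  have Dp: "sets D = sets borel_ctensors" "prob_space D"
    unfolding D_def
    by (auto intro!: prob_space_return simp: space_borel_ctensors sym_tensors_def)
  have AEbad: "AE x in lebesgue_on \<Omega>. \<not> bad \<theta> x" for \<theta>
  proof -
    have "AE x in lebesgue_on \<Omega>. (AE y in lebesgue_on \<Omega>. solves_at F u \<theta> y) \<longrightarrow> solves_at F u \<theta> x" for F
      by (cases "AE y in lebesgue_on \<Omega>. solves_at F u \<theta> y") auto
    from this[of tangential_op] this[of normal_op]
    show ?thesis by eventually_elim (auto simp: bad_def Fs_def)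
  qed
  have badset: "{x \<in> \<Omega>. bad \<theta> x} \<in> sets (lebesgue_on \<Omega>)" for \<theta>
  proof -
    obtain N where N: "N \<in> null_sets (lebesgue_on \<Omega>)" "{x \<in> \<Omega>. bad \<theta> x} \<subseteq> N"
      using AEbad[of \<theta>] by (auto simp: eventually_ae_filter)
    then have "N \<in> null_sets lebesgue"
      using leb by (simp add: null_sets_restrict_space)
    then have "{x \<in> \<Omega>. bad \<theta> x} \<in> sets lebesgue"
      using N(2) by (meson null_sets_completion_subset null_setsD2)
    then show ?thesis using leb by (simp add: sets_restrict_space_iff)
  qed
  have young: "young_measure \<Omega> (rep \<theta>)" if "diffuse_hessian \<Omega> u \<theta>" for \<theta>
  proof -
    have y: "young_measure \<Omega> (c \<theta>)" using c[OF that] by (simp add: diffuse_hessian_def)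
    have "(\<lambda>x. measure (rep \<theta> x) U) \<in> borel_measurable (lebesgue_on \<Omega>)"
      if U: "U \<in> sets borel_ctensors" for U
    proof -
      have "(\<lambda>x. if bad (c \<theta>) x then measure D U else measure (c \<theta> x) U) \<in> borel_measurable (lebesgue_on \<Omega>)"
        using y U badset by (intro measurable_If) (auto simp: young_measure_def)
      also have "(\<lambda>x. if bad (c \<theta>) x then measure D U else measure (c \<theta> x) U) = (\<lambda>x. measure (rep \<theta> x) U)"
        by (auto simp: rep_def)
      finally show ?thesis .
    qed
    then show ?thesis using y Dp by (auto simp: young_measure_def rep_def)
  qed
  have eq: "AE x in lebesgue_on \<Omega>. rep \<theta> x = \<theta> x \<and> rep \<theta> x = c \<theta> x" if "diffuse_hessian \<Omega> u \<theta>" for \<theta>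
    using c[OF that, THEN conjunct2] AEbad[of "c \<theta>"]
    by eventually_elim (auto simp: rep_def)
  have everywhere: "\<forall>x\<in>\<Omega>. solves_at F u (rep \<theta>) x"
    if "diffuse_hessian \<Omega> u \<theta>" "F \<in> Fs" "AE x in lebesgue_on \<Omega>. solves_at F u (rep \<theta>) x" for F \<theta>
  proof -
    have "AE x in lebesgue_on \<Omega>. solves_at F u (c \<theta>) x"
      using that(3) eq[OF that(1)] by eventually_elim (auto simp: solves_at_def)
    then have "solves_at F u (c \<theta>) x" if "\<not> bad (c \<theta>) x" for x
      using that \<open>F \<in> Fs\<close> by (auto simp: bad_def)
    then show ?thesis
      using D0[OF \<open>F \<in> Fs\<close>] by (force simp: rep_def solves_at_def)
  qed
  have cls: "rep \<theta> = rep \<theta>'" if "AE x in lebesgue_on \<Omega>. \<theta> x = \<theta>' x" for \<theta> \<theta>'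
  proof -
    have "(AE x in lebesgue_on \<Omega>. \<theta> x = \<eta> x) = (AE x in lebesgue_on \<Omega>. \<theta>' x = \<eta> x)" for \<eta>
      using that by (intro AE_cong_simp eventually_subst) (auto elim: eventually_mono)
    then have "c \<theta> = c \<theta>'" by (simp add: c_def)
    then show ?thesis
      unfolding rep_def by (rule arg_cong[of _ _ "\<lambda>\<eta> x. if bad \<eta> x then D else \<eta> x"])
  qed
  have "representative_choice \<Omega> u rep"
    unfolding representative_choice_def Fs_def[symmetric]
  proof (intro conjI allI impI ballI)
    fix \<theta> assume d: "diffuse_hessian \<Omega> u \<theta>"
    show "young_measure \<Omega> (rep \<theta>)" by (rule young[OF d])
    show "AE x in lebesgue_on \<Omega>. rep \<theta> x = \<theta> x" using eq[OF d] by eventually_elim simp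
  next
    fix \<theta> F x assume "diffuse_hessian \<Omega> u \<theta>" "F \<in> Fs"
      "AE x in lebesgue_on \<Omega>. solves_at F u (rep \<theta>) x" "x \<in> \<Omega>"
    then show "solves_at F u (rep \<theta>) x" using everywhere by blast
  next
    fix \<theta> \<theta>' x
    assume "diffuse_hessian \<Omega> u \<theta> \<and> diffuse_hessian \<Omega> u \<theta>' \<and> (AE x in lebesgue_on \<Omega>. \<theta> x = \<theta>' x)"
    then show "rep \<theta> x = rep \<theta>' x" using cls by metis
  qed
  then show ?thesis by blast
qed


section \<open>Sets of affine maps\<close>

definition Linf_norm :: "(real^'n) set \<Rightarrow> (real^'n \<Rightarrow> real^'n^'N) \<Rightarrow> ereal" where
  "Linf_norm S f = esssup (lebesgue_on S) (\<lambda>x. ereal (norm (f x)))"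

definition compactly_inside :: "(real^'n) set \<Rightarrow> (real^'n) set \<Rightarrow> bool" where
  "compactly_inside \<Omega>' \<Omega> \<longleftrightarrow> compact (closure \<Omega>') \<and> closure \<Omega>' \<subseteq> \<Omega>"

definition max_set :: "(real^'n) set \<Rightarrow> (real^'n \<Rightarrow> real^'N) \<Rightarrow> (real^'n) set" where
  "max_set \<Omega>' u =
     {x \<in> closure \<Omega>'. ereal (norm (jacobian u (at x))) = Linf_norm \<Omega>' (\<lambda>y. jacobian u (at y))}"

definition affine_map :: "(real^'n \<Rightarrow> real^'N) \<Rightarrow> bool" where
  "affine_map A \<longleftrightarrow> (\<exists>M b. \<forall>y. A y = M *v y + b)"

definition tangential_affine_maps ::
    "(real^'n) set \<Rightarrow> (real^'n \<Rightarrow> real^'N) \<Rightarrow>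
     ((real^'n \<Rightarrow> (real^'n^'n^'N) option measure) \<Rightarrow>
      (real^'n \<Rightarrow> (real^'n^'n^'N) option measure)) \<Rightarrow>
     (real^'n) set \<Rightarrow> (real^'n \<Rightarrow> real^'N) set" where
  "tangential_affine_maps \<Omega> u rep \<Omega>' =
     range (\<lambda>c. (\<lambda>_. c)) \<union>
     {A. affine_map A \<and>
         (\<exists>\<xi> x \<theta> X. x \<in> max_set \<Omega>' u \<and> diffuse_hessian \<Omega> u \<theta> \<and> X \<in> supp_star (rep \<theta> x) \<and>
            (\<forall>y. jacobian A (at y) = outer \<xi> (contract X (jacobian u (at x)))))}"

definition normal_matrices ::
    "real^'n^'N \<Rightarrow> real^'n^'n^'N \<Rightarrow> real^'N \<Rightarrow> (real^'n^'N) set" where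
  "normal_matrices P X a = (if P \<noteq> 0 then {Q. P \<bullet> Q = - trace_against a X} else {0})"

definition normal_affine_maps ::
    "(real^'n) set \<Rightarrow> (real^'n \<Rightarrow> real^'N) \<Rightarrow>
     ((real^'n \<Rightarrow> (real^'n^'n^'N) option measure) \<Rightarrow>
      (real^'n \<Rightarrow> (real^'n^'n^'N) option measure)) \<Rightarrow>
     (real^'n) set \<Rightarrow> (real^'n \<Rightarrow> real^'N) set" where
  "normal_affine_maps \<Omega> u rep \<Omega>' =
     range (\<lambda>c. (\<lambda>_. c)) \<union>
     {A. affine_map A \<and>
         (\<exists>x \<theta> X. x \<in> max_set \<Omega>' u \<and> diffuse_hessian \<Omega> u \<theta> \<and> X \<in> supp_star (rep \<theta> x) \<and>
            A x \<in> orthogonal_comp (mat_range (jacobian u (at x))) \<and>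
            (\<forall>y. jacobian A (at y) \<in> normal_matrices (jacobian u (at x)) X (A x)))}"

end

theory Submission
  imports Defs
begin

text \<open>
  Both systems say that a matrix built from $\mathbf{X}$ is orthogonal to $P = Du(x)$:
  $P\otimes P:\mathbf{X} = P(\mathbf{X}:P)$, so $\xi\cdot(P\otimes P:\mathbf{X}) = P : (\xi\otimes(\mathbf{X}:P))$,
  and, for the trace $t_\alpha = \sum_i \mathbf{X}_{\alpha ii}$, $a\cdot[P]^\bot t = (a\otimes I):\mathbf{X}$ for $a\in R(P)^\bot$.
  If $P : Q = 0$ then $|P|\le|P+Q|$, and at a point of \<open>max_set \<Omega>' u\<close> this pointwise inequality
  is one between suprema. Conversely, as $|Du|$ has no local minimum at $x$, the sets
  $\{|Du| < |Du(x)|\}\cap B_\varepsilon(x)$ are nonempty and have $x$ in their \<open>max_set\<close>; letting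
  $\varepsilon\to0$, minimality on them gives $|P|\le|P+tQ|$ for all real $t$, hence $P : Q = 0$.
\<close>

section \<open>Tensor algebra\<close>

text \<open>The symmetry of \<open>X\<close> exchanges the two lower indices, after which the factor
  \<open>P $ \<alpha> $ i\<close> comes out of the sums. The factored form lets pairings with this
  vector be read as pairings of \<open>P\<close> with rank-one matrices.\<close>

lemma tangential_op_eq:
  assumes "X \<in> sym_tensors"
  shows "tangential_op P X = P *v contract X P"
proof -
  have "(\<Sum>\<beta>\<in>UNIV. \<Sum>i\<in>UNIV. \<Sum>j\<in>UNIV. P $ \<alpha> $ i * P $ \<beta> $ j * X $ \<beta> $ i $ j)
      = (\<Sum>i\<in>UNIV. P $ \<alpha> $ i * (\<Sum>\<beta>\<in>UNIV. \<Sum>j\<in>UNIV. X $ \<beta> $ j $ i * P $ \<beta> $ j))" for \<alpha>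
  proof -
    have "X $ \<beta> $ j $ i = X $ \<beta> $ i $ j" for \<beta> i j
      using assms by (auto simp: sym_tensors_def)
    then show ?thesis
      by (subst sum.swap) (simp add: sum_distrib_left mult_ac)
  qed
  then show ?thesis
    by (simp add: tangential_op_def contract_def matrix_vector_mult_def vec_eq_iff)
qed

lemma inner_outer: "P \<bullet> outer \<xi> v = \<xi> \<bullet> (P *v v)"
  by (simp add: inner_vec_def outer_def matrix_vector_mult_def sum_distrib_left mult_ac)

lemma outer_scaleR: "outer (t *\<^sub>R \<xi>) v = t *\<^sub>R outer \<xi> v"
  by (simp add: outer_def vec_eq_iff mult_ac)

text \<open>For a hessian \<open>X\<close> this is the Laplacian.\<close>

definition tensor_trace :: "real^'n^'n^'N \<Rightarrow> real^'N" where
  "tensor_trace X = (\<chi> \<alpha>. \<Sum>i\<in>UNIV. X $ \<alpha> $ i $ i)"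

lemma trace_against_eq: "trace_against a X = a \<bullet> tensor_trace X"
  by (simp add: trace_against_def tensor_trace_def inner_vec_def sum_distrib_left)

text \<open>The difference of the two candidates lies in \<open>W\<close> and is orthogonal to both
  residuals, hence to their difference, which is itself up to sign.\<close>

lemma orth_proj_eqI:
  assumes "subspace W" "z \<in> W" "\<And>w. w \<in> W \<Longrightarrow> orthogonal (y - z) w"
  shows "orth_proj W y = z"
proof -
  let ?p = "orth_proj W y"
  have "?p - z \<in> W" "orthogonal (y - z) (?p - z)" "orthogonal (y - ?p) (?p - z)"
    using orth_proj_props[OF assms(1), of y] assms by (auto simp: subspace_diff)
  then have "(?p - z) \<bullet> (?p - z) = 0"
    by (simp add: orthogonal_def inner_diff_left)
  then show ?thesis by simp
qed

text \<open>Linearity is what makes the matrix \<open>perp_proj P\<close> act as the projection it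
  is built from.\<close>

lemma linear_orth_proj:
  fixes W :: "(real^'N) set"
  assumes "subspace W"
  shows "linear (orth_proj W)"
proof (rule linearI)
  note p = orth_proj_props[OF assms]
  fix x y :: "real^'N" and c :: real
  show "orth_proj W (x + y) = orth_proj W x + orth_proj W y"
    using p[of x] p[of y] assms
    by (intro orth_proj_eqI)
      (auto simp: subspace_add orthogonal_def inner_diff_left inner_add_left)
  show "orth_proj W (c *\<^sub>R x) = c *\<^sub>R orth_proj W x"
    using p[of x] assms
    by (intro orth_proj_eqI) (auto simp: subspace_scale orthogonal_def inner_diff_left)
qed

lemma normal_op_eq:
  "normal_op P X =
     (norm P)\<^sup>2 *\<^sub>R orth_proj (orthogonal_comp (mat_range P)) (tensor_trace X)"
proof -
  have "(\<chi> \<alpha>. \<Sum>\<beta>\<in>UNIV. \<Sum>i\<in>UNIV. perp_proj P $ \<alpha> $ \<beta> * X $ \<beta> $ i $ i)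
      = perp_proj P *v tensor_trace X"
    by (simp add: matrix_vector_mult_def tensor_trace_def sum_distrib_left)
  also have "\<dots> = orth_proj (orthogonal_comp (mat_range P)) (tensor_trace X)"
    unfolding perp_proj_def
    by (intro matrix_works)
      (simp add: linear_matrix_vector_mul_eq linear_orth_proj subspace_orthogonal_comp)
  finally show ?thesis by (simp add: normal_op_def)
qed

lemma orth_proj_eq_0_iff:
  assumes "subspace W"
  shows "orth_proj W y = 0 \<longleftrightarrow> (\<forall>w\<in>W. w \<bullet> y = 0)"
  using orth_proj_props[OF assms, of y] orth_proj_eqI[OF assms subspace_0[OF assms]]
  by (auto simp: orthogonal_def inner_commute)

text \<open>The factor \<open>(norm P)\<^sup>2\<close> cancels, and a projection vanishes exactly on
  vectors orthogonal to its target. The test vectors \<open>a\<close> are the values allowed for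
  A(x) in the normal affine maps.\<close>

lemma normal_op_eq_0_iff:
  assumes "P \<noteq> 0"
  shows "normal_op P X = 0 \<longleftrightarrow>
    (\<forall>a\<in>orthogonal_comp (mat_range P). trace_against a X = 0)"
  using assms
  by (simp add: normal_op_eq trace_against_eq orth_proj_eq_0_iff subspace_orthogonal_comp)

lemma norm_le_norm_add:
  fixes P Q :: "'a::real_inner"
  assumes "P \<bullet> Q = 0"
  shows "norm P \<le> norm (P + Q)"
  using assms by (simp add: norm_le inner_add_left inner_add_right inner_commute)

lemma inner_eq_0_if_norm_le:
  fixes P Q :: "'a::real_inner"
  assumes "\<And>t. norm P \<le> norm (P + t *\<^sub>R Q)"
  shows "P \<bullet> Q = 0"
proof (cases "Q = 0")
  case False
  \<comment> \<open>The minimiser of the quadratic polynomial t \<mapsto> |P + tQ|^2.\<close>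
  define t where "t = - (P \<bullet> Q) / (Q \<bullet> Q)"
  have "P \<bullet> P \<le> (P + t *\<^sub>R Q) \<bullet> (P + t *\<^sub>R Q)"
    using assms[of t] by (simp add: norm_le)
  also have "\<dots> = P \<bullet> P + 2 * t * (P \<bullet> Q) + t * t * (Q \<bullet> Q)"
    by (simp add: inner_add_left inner_add_right inner_commute)
  also have "\<dots> = P \<bullet> P - (P \<bullet> Q)\<^sup>2 / (Q \<bullet> Q)"
    using False by (simp add: t_def field_simps power2_eq_square)
  finally have "(P \<bullet> Q)\<^sup>2 / (Q \<bullet> Q) \<le> 0" by simp
  moreover have "Q \<bullet> Q > 0" using False by simp
  ultimately show ?thesis by (simp add: divide_le_0_iff)
qed simp

lemma jacobian_affine:
  fixes M :: "real^'n^'N"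
  assumes "\<And>y. A y = M *v y + b"
  shows "jacobian A (at x) = M"
proof -
  have "A = (\<lambda>y. M *v y + b)" using assms by blast
  then have "(A has_derivative (*v) M) (at x)"
    by (simp only:)
      (intro has_derivative_add_const bounded_linear_imp_has_derivative
        matrix_vector_mul_bounded_linear)
  then have "frechet_derivative A (at x) = (*v) M"
    by (rule frechet_derivative_at[symmetric])
  then show ?thesis by (simp add: jacobian_def matrix_of_matrix_vector_mul)
qed

section \<open>Essential suprema of continuous functions\<close>

lemma norm_measurable_lebesgue_on:
  fixes f :: "real^'n \<Rightarrow> real^'n^'N"
  assumes "open S" "continuous_on S f"
  shows "(\<lambda>x. ereal (norm (f x))) \<in> borel_measurable (lebesgue_on S)"
proof -
  have "(\<lambda>x. norm (f x)) \<in> borel_measurable (lebesgue_on S)"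
    using assms by (intro continuous_imp_measurable_on_sets_lebesgue continuous_on_norm) auto
  then show ?thesis by simp
qed

lemma Linf_norm_le:
  assumes "open S" "continuous_on S f" "\<And>y. y \<in> S \<Longrightarrow> norm (f y) \<le> c"
  shows "Linf_norm S f \<le> ereal c"
  unfolding Linf_norm_def
  using assms by (intro esssup_I norm_measurable_lebesgue_on AE_I2) auto

text \<open>Otherwise |f| exceeds some c above the essential supremum near x, hence on a nonempty
  open part of S, which cannot be null. The larger set T carries the continuity of f up to x, which
  may be a boundary point of S.\<close>

lemma norm_le_Linf_norm:
  assumes "open S" "S \<subseteq> T" "continuous_on T f" "x \<in> T" "x \<in> closure S"
  shows "ereal (norm (f x)) \<le> Linf_norm S f"
proof (rule ccontr)
  assume "\<not> ?thesis"
  then obtain c where c: "Linf_norm S f < ereal c" "c < norm (f x)"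
    using ereal_dense2[of "Linf_norm S f" "ereal (norm (f x))"] by (auto simp: not_le)
  define V where "V = {y \<in> S. c < norm (f y)}"
  have contN: "continuous_on T (\<lambda>y. norm (f y))" by (intro continuous_on_norm assms)
  have "open V"
    using continuous_open_preimage[OF continuous_on_subset[OF contN assms(2)] assms(1) open_greaterThan[of c]]
    by (simp add: V_def vimage_def Int_def)
  have "AE y in lebesgue_on S. ereal (norm (f y)) \<le> Linf_norm S f"
    unfolding Linf_norm_def by (rule esssup_AE)
  then have "AE y in lebesgue_on S. y \<in> - V"
    by eventually_elim (use c(1) in \<open>auto simp: V_def dest: le_less_trans\<close>)
  then have "AE y\<in>V in lebesgue. y \<in> - V"
    using assms(1) by (auto simp: AE_restrict_space_iff V_def elim: eventually_mono)
  \<comment> \<open>An open set almost all of whose points lie in a closed set is contained in it;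
    here the closed set is the complement of \<open>V\<close>.\<close>
  then have "V = {}"
    using mem_closed_if_AE_lebesgue_open[of V "- V"] \<open>open V\<close> by blast
  moreover obtain d where d: "d > 0" "\<And>y. y \<in> T \<Longrightarrow> dist y x < d \<Longrightarrow> c < norm (f y)"
  proof -
    have "\<forall>\<^sub>F y in at x within T. c < norm (f y)"
      using contN c(2) assms(4) by (auto simp: continuous_on_def intro: order_tendstoD)
    then show ?thesis
      using c(2) that unfolding eventually_at by metis
  qed
  moreover obtain y where "y \<in> S" "dist y x < d"
    using assms(5) d(1) by (auto simp: closure_approachable)
  ultimately show False using assms(2) by (auto simp: V_def)
qed

section \<open>Variation at a point of the maximal set\<close>

lemma max_set_norm_le:
  assumes "open \<Omega>'" "compactly_inside \<Omega>' \<Omega>" "continuous_on \<Omega> (\<lambda>x. jacobian u (at x))"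
    and "x \<in> max_set \<Omega>' u" "jacobian u (at x) \<bullet> Q = 0"
  shows "Linf_norm \<Omega>' (\<lambda>x. jacobian u (at x)) \<le> Linf_norm \<Omega>' (\<lambda>x. jacobian u (at x) + Q)"
proof -
  have x: "x \<in> closure \<Omega>'" "x \<in> \<Omega>" "\<Omega>' \<subseteq> \<Omega>"
    using assms(2,4) closure_subset by (auto simp: max_set_def compactly_inside_def)
  have "Linf_norm \<Omega>' (\<lambda>x. jacobian u (at x)) = ereal (norm (jacobian u (at x)))"
    using assms(4) by (simp add: max_set_def)
  also have "\<dots> \<le> ereal (norm (jacobian u (at x) + Q))"
    using norm_le_norm_add[OF assms(5)] by simp
  also have "\<dots> \<le> Linf_norm \<Omega>' (\<lambda>x. jacobian u (at x) + Q)"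
    using x assms(1,3) by (intro norm_le_Linf_norm[where T = \<Omega>] continuous_intros) auto
  finally show ?thesis .
qed

text \<open>Minimality on a small set near x compares essential suprema; since Du is almost constant
  there, they become the values at x up to an error e.\<close>

lemma norm_le_if_minimal:
  assumes "open \<Omega>" "continuous_on \<Omega> (\<lambda>x. jacobian u (at x))" "x \<in> \<Omega>"
    and no_min: "\<not> eventually (\<lambda>y. norm (jacobian u (at x)) \<le> norm (jacobian u (at y)))
                     (at x within \<Omega>)"
    and minimal: "\<And>\<Omega>'. open \<Omega>' \<Longrightarrow> \<Omega>' \<noteq> {} \<Longrightarrow> compactly_inside \<Omega>' \<Omega> \<Longrightarrow> x \<in> max_set \<Omega>' u \<Longrightarrow>
      Linf_norm \<Omega>' (\<lambda>x. jacobian u (at x)) \<le> Linf_norm \<Omega>' (\<lambda>x. jacobian u (at x) + Q)"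
  shows "norm (jacobian u (at x)) \<le> norm (jacobian u (at x) + Q)"
proof (rule field_le_epsilon)
  let ?D = "\<lambda>x. jacobian u (at x)"
  fix e :: real assume "e > 0"
  obtain r where r: "r > 0" "cball x r \<subseteq> \<Omega>"
    using assms(1,3) open_contains_cball by blast
  obtain d where d: "d > 0" "\<And>y. y \<in> \<Omega> \<Longrightarrow> dist y x < d \<Longrightarrow> dist (?D y) (?D x) < e"
    using assms(2,3) \<open>e > 0\<close> by (meson continuous_on_iff)
  \<comment> \<open>The radius \<open>r\<close> keeps the closure of \<open>S\<close> inside
    \<Omega>, and \<open>d\<close> bounds the oscillation of Du on \<open>S\<close> by
    \<open>e\<close>.\<close>
  define S where "S = {y \<in> \<Omega>. norm (?D y) < norm (?D x)} \<inter> ball x (min r d)"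
  have "open S"
    using continuous_open_preimage[OF continuous_on_norm[OF assms(2)] assms(1) open_lessThan[of "norm (?D x)"]]
    unfolding S_def by (intro open_Int open_ball) (simp add: vimage_def Int_def)
  \<comment> \<open>Since x is not a local minimum, \<open>S\<close> has points arbitrarily close to
    x. So x is in the closure of \<open>S\<close>, though the strict inequality excludes it from
    \<open>S\<close>.\<close>
  have near: "\<exists>y\<in>S. dist y x < s" if "s > 0" for s
  proof -
    have "min s (min r d) > 0" using that r d by simp
    then obtain y where "y \<in> \<Omega>" "y \<noteq> x" "dist y x < min s (min r d)" "norm (?D y) < norm (?D x)"
      using no_min unfolding eventually_at by (metis not_le)
    then show ?thesis by (auto simp: S_def dist_commute)
  qed
  then have x: "x \<in> closure S" by (auto simp: closure_approachable)
  have "S \<noteq> {}" using near[of 1] by auto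
  have "S \<subseteq> \<Omega>" by (auto simp: S_def)
  have "S \<subseteq> cball x r" by (auto simp: S_def)
  then have cl: "closure S \<subseteq> cball x r" by (simp add: closure_minimal)
  then have inside: "compactly_inside S \<Omega>"
    using r(2) unfolding compactly_inside_def
    by (meson bounded_cball bounded_subset closed_closure compact_eq_bounded_closed subset_trans)
  have contS: "continuous_on S ?D" using assms(2) \<open>S \<subseteq> \<Omega>\<close> continuous_on_subset by blast
  \<comment> \<open>The supremum over \<open>S\<close> is exactly |Du(x)|: the bound from above is
    built into \<open>S\<close>, the one from below holds because x is in its closure.\<close>
  have "Linf_norm S ?D \<le> ereal (norm (?D x))"
    using \<open>open S\<close> contS by (intro Linf_norm_le) (auto simp: S_def)
  moreover have ge: "ereal (norm (?D x)) \<le> Linf_norm S ?D"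
    using \<open>open S\<close> \<open>S \<subseteq> \<Omega>\<close> assms(2,3) x by (rule norm_le_Linf_norm)
  ultimately have "x \<in> max_set S u" using x by (auto simp: max_set_def)
  note ge
  also have "Linf_norm S ?D \<le> Linf_norm S (\<lambda>x. ?D x + Q)"
    using \<open>open S\<close> \<open>S \<noteq> {}\<close> inside \<open>x \<in> max_set S u\<close> by (rule minimal)
  also have "\<dots> \<le> ereal (norm (?D x + Q) + e)"
  proof (intro Linf_norm_le continuous_intros contS \<open>open S\<close>)
    fix y assume "y \<in> S"
    then have "norm (?D y - ?D x) < e"
      using d(2)[of y] by (auto simp: S_def dist_commute dist_norm norm_minus_commute)
    then show "norm (?D y + Q) \<le> norm (?D x + Q) + e"
      using norm_triangle_ineq[of "?D x + Q" "?D y - ?D x"] by (simp add: add.commute)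
  qed
  finally show "norm (?D x) \<le> norm (?D x + Q) + e" by simp
qed

section \<open>The two characterisations\<close>

text \<open>The affine maps refer to single points x, so the almost everywhere condition must be
  turned into a pointwise one. It passes to \<open>rep \<theta>\<close>, which agrees with \<theta>
  almost everywhere, and the convention on representatives extends it to all of \<Omega>.\<close>

lemma D_solution_iff_rep:
  assumes "representative_choice \<Omega> u rep" "F \<in> {tangential_op, normal_op}"
  shows "D_solution F \<Omega> u \<longleftrightarrow>
    (\<forall>\<theta>. diffuse_hessian \<Omega> u \<theta> \<longrightarrow> (\<forall>x\<in>\<Omega>. solves_at F u (rep \<theta>) x))"
proof -
  have "(AE x in lebesgue_on \<Omega>. solves_at F u \<theta> x) \<longleftrightarrow> (\<forall>x\<in>\<Omega>. solves_at F u (rep \<theta>) x)"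
    if "diffuse_hessian \<Omega> u \<theta>" for \<theta>
  proof
    have eq: "AE x in lebesgue_on \<Omega>. rep \<theta> x = \<theta> x"
      and everywhere: "(AE x in lebesgue_on \<Omega>. solves_at F u (rep \<theta>) x) \<Longrightarrow>
        (\<forall>x\<in>\<Omega>. solves_at F u (rep \<theta>) x)"
      using assms that unfolding representative_choice_def by blast+
    {
      assume "AE x in lebesgue_on \<Omega>. solves_at F u \<theta> x"
      then have "AE x in lebesgue_on \<Omega>. solves_at F u (rep \<theta>) x"
        using eq by eventually_elim (simp add: solves_at_def)
      then show "\<forall>x\<in>\<Omega>. solves_at F u (rep \<theta>) x" by (rule everywhere)
    next
      assume "\<forall>x\<in>\<Omega>. solves_at F u (rep \<theta>) x"
      then have "AE x in lebesgue_on \<Omega>. solves_at F u (rep \<theta>) x" by (intro AE_I2) simp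
      then show "AE x in lebesgue_on \<Omega>. solves_at F u \<theta> x"
        using eq by eventually_elim (simp add: solves_at_def)
    }
  qed
  then show ?thesis by (auto simp: D_solution_def)
qed

lemma jacobian_const: "jacobian (\<lambda>_::real^'n. c :: real^'N) (at x) = 0"
  by (rule jacobian_affine[of _ _ c]) simp

lemma affine_mapI: "affine_map (\<lambda>y. M *v y + b)"
  by (auto simp: affine_map_def)

lemma affine_map_jacobian_const:
  assumes "affine_map A"
  obtains M where "\<And>y. jacobian A (at y) = M"
  using assms jacobian_affine[of A] unfolding affine_map_def by blast

theorem theorem12:
  fixes \<Omega> :: "(real^'n) set" and u :: "real^'n \<Rightarrow> real^'N"
    and rep :: "(real^'n \<Rightarrow> (real^'n^'n^'N) option measure) \<Rightarrow>
                (real^'n \<Rightarrow> (real^'n^'n^'N) option measure)"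
  assumes "open \<Omega>"
    and "C1_on \<Omega> u"
    and no_local_min:
      "\<not> (\<exists>x\<in>\<Omega>. eventually (\<lambda>y. norm (jacobian u (at x)) \<le> norm (jacobian u (at y)))
                      (at x within \<Omega>))"
    and "representative_choice \<Omega> u rep"
  shows "(D_solution tangential_op \<Omega> u \<longleftrightarrow>
           (\<forall>\<Omega>'. open \<Omega>' \<and> \<Omega>' \<noteq> {} \<and> compactly_inside \<Omega>' \<Omega> \<longrightarrow>
              (\<forall>A\<in>tangential_affine_maps \<Omega> u rep \<Omega>'.
                 Linf_norm \<Omega>' (\<lambda>x. jacobian u (at x))
                   \<le> Linf_norm \<Omega>' (\<lambda>x. jacobian u (at x) + jacobian A (at x))))) \<and>
         (D_solution normal_op \<Omega> u \<longleftrightarrow>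
           (\<forall>\<Omega>'. open \<Omega>' \<and> \<Omega>' \<noteq> {} \<and> compactly_inside \<Omega>' \<Omega> \<longrightarrow>
              (\<forall>A\<in>normal_affine_maps \<Omega> u rep \<Omega>'.
                 Linf_norm \<Omega>' (\<lambda>x. jacobian u (at x))
                   \<le> Linf_norm \<Omega>' (\<lambda>x. jacobian u (at x) + jacobian A (at x)))))"
    (is "(_ \<longleftrightarrow> ?min_tan) \<and> (_ \<longleftrightarrow> ?min_nor)")
proof (intro conjI iffI)
  let ?D = "\<lambda>x. jacobian u (at x)"
  have cont: "continuous_on \<Omega> ?D" using assms(2) by (simp add: C1_on_def)
  note iff_rep = D_solution_iff_rep[OF assms(4)]
  have in_\<Omega>: "x \<in> \<Omega>" if "compactly_inside \<Omega>' \<Omega>" "x \<in> max_set \<Omega>' u" for x \<Omega>'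
    using that by (auto simp: compactly_inside_def max_set_def)

  \<comment> \<open>From solutions to minimality\<close>
  show ?min_tan if sol: "D_solution tangential_op \<Omega> u"
  proof (intro allI impI ballI)
    fix \<Omega>' A
    assume \<Omega>': "open \<Omega>' \<and> \<Omega>' \<noteq> {} \<and> compactly_inside \<Omega>' \<Omega>"
      and "A \<in> tangential_affine_maps \<Omega> u rep \<Omega>'"
    then consider c where "A = (\<lambda>_. c)"
      | \<xi> x \<theta> X where "x \<in> max_set \<Omega>' u" "diffuse_hessian \<Omega> u \<theta>" "X \<in> supp_star (rep \<theta> x)"
          "\<And>y. jacobian A (at y) = outer \<xi> (contract X (?D x))"
      unfolding tangential_affine_maps_def by blast
    then show "Linf_norm \<Omega>' ?D \<le> Linf_norm \<Omega>' (\<lambda>x. ?D x + jacobian A (at x))"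
    proof cases
      case 1
      then show ?thesis by (simp add: jacobian_const)
    next
      case (2 \<xi> x \<theta> X)
      have "X \<in> sym_tensors" using 2(3) by (simp add: supp_star_def)
      moreover have "tangential_op (?D x) X = 0"
        using sol 2 \<Omega>' in_\<Omega> by (auto simp: iff_rep solves_at_def)
      \<comment> \<open>By \<open>inner_outer\<close> the pairing equals the inner product of \<xi>
        with the vanishing vector \<open>tangential_op (?D x) X\<close>.\<close>
      ultimately have "?D x \<bullet> outer \<xi> (contract X (?D x)) = 0"
        by (simp add: inner_outer tangential_op_eq)
      then show ?thesis
        using \<Omega>' cont 2(1) unfolding 2(4) by (intro max_set_norm_le) auto
    qed
  qed

  show ?min_nor if sol: "D_solution normal_op \<Omega> u"
  proof (intro allI impI ballI)
    fix \<Omega>' A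
    assume \<Omega>': "open \<Omega>' \<and> \<Omega>' \<noteq> {} \<and> compactly_inside \<Omega>' \<Omega>"
      and "A \<in> normal_affine_maps \<Omega> u rep \<Omega>'"
    then consider c where "A = (\<lambda>_. c)"
      | x \<theta> X where "affine_map A" "x \<in> max_set \<Omega>' u" "diffuse_hessian \<Omega> u \<theta>"
          "X \<in> supp_star (rep \<theta> x)" "A x \<in> orthogonal_comp (mat_range (?D x))"
          "\<And>y. jacobian A (at y) \<in> normal_matrices (?D x) X (A x)"
      unfolding normal_affine_maps_def by blast
    then show "Linf_norm \<Omega>' ?D \<le> Linf_norm \<Omega>' (\<lambda>x. ?D x + jacobian A (at x))"
    proof cases
      case 1
      then show ?thesis by (simp add: jacobian_const)
    next
      case (2 x \<theta> X)
      obtain M where M: "\<And>y. jacobian A (at y) = M"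
        using affine_map_jacobian_const[OF 2(1)] by blast
      have "normal_op (?D x) X = 0"
        using sol 2 \<Omega>' in_\<Omega> by (auto simp: iff_rep solves_at_def)
      \<comment> \<open>If Du(x) = 0 this is trivial. Otherwise the product is
        \<open>- trace_against (A x) X\<close>, and A(x) is an admissible test vector for
        \<open>normal_op (?D x) X = 0\<close>.\<close>
      then have "?D x \<bullet> M = 0"
        using 2(5) 2(6)[of x] normal_op_eq_0_iff[of "?D x" X]
        by (auto simp: M normal_matrices_def split: if_splits)
      then show ?thesis
        using \<Omega>' cont 2(2) unfolding M by (intro max_set_norm_le) auto
    qed
  qed

  \<comment> \<open>From minimality to solutions\<close>
  have orth: "?D x \<bullet> Q = 0"
    if "x \<in> \<Omega>" and "\<And>t \<Omega>'. open \<Omega>' \<Longrightarrow> \<Omega>' \<noteq> {} \<Longrightarrow> compactly_inside \<Omega>' \<Omega> \<Longrightarrow>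
      x \<in> max_set \<Omega>' u \<Longrightarrow> Linf_norm \<Omega>' ?D \<le> Linf_norm \<Omega>' (\<lambda>x. ?D x + t *\<^sub>R Q)" for x Q
    using that no_local_min
    by (intro inner_eq_0_if_norm_le norm_le_if_minimal[OF assms(1) cont]) auto

  show "D_solution tangential_op \<Omega> u" if min: ?min_tan
    unfolding iff_rep[of tangential_op, simplified] solves_at_def
  proof (intro allI impI ballI)
    fix \<theta> x X
    assume \<theta>: "diffuse_hessian \<Omega> u \<theta>" and x: "x \<in> \<Omega>" and X: "X \<in> supp_star (rep \<theta> x)"
    define v where "v = contract X (?D x)"
    \<comment> \<open>With \<xi> = Du(x)v the pairing is |Du(x)v|^2, so this single direction yields
      the whole system. The factor t is absorbed into \<xi>.\<close>
    have "?D x \<bullet> outer (?D x *v v) v = 0"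
    proof (rule orth[OF x])
      fix t \<Omega>'
      assume \<Omega>': "open \<Omega>'" "\<Omega>' \<noteq> {}" "compactly_inside \<Omega>' \<Omega>" "x \<in> max_set \<Omega>' u"
      let ?Q = "outer (t *\<^sub>R (?D x *v v)) v"
      have J: "jacobian (\<lambda>y. ?Q *v y + 0) (at y) = ?Q" for y by (rule jacobian_affine) simp
      have "(\<lambda>y. ?Q *v y + 0) \<in> tangential_affine_maps \<Omega> u rep \<Omega>'"
        unfolding tangential_affine_maps_def
        using \<Omega>'(4) \<theta> X J affine_mapI[of ?Q 0] unfolding v_def by blast
      then show "Linf_norm \<Omega>' ?D \<le> Linf_norm \<Omega>' (\<lambda>y. ?D y + t *\<^sub>R outer (?D x *v v) v)"
        using min \<Omega>' J by (fastforce simp: outer_scaleR)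
    qed
    moreover have "X \<in> sym_tensors" using X by (simp add: supp_star_def)
    ultimately show "tangential_op (?D x) X = 0"
      by (simp add: inner_outer tangential_op_eq v_def)
  qed

  show "D_solution normal_op \<Omega> u" if min: ?min_nor
    unfolding iff_rep[of normal_op, simplified] solves_at_def
  proof (intro allI impI ballI)
    fix \<theta> x X
    assume \<theta>: "diffuse_hessian \<Omega> u \<theta>" and x: "x \<in> \<Omega>" and X: "X \<in> supp_star (rep \<theta> x)"
    show "normal_op (?D x) X = 0"
    proof (cases "?D x = 0")
      case True
      then show ?thesis by (simp add: normal_op_def)
    next
      case False
      have "trace_against a X = 0" if a: "a \<in> orthogonal_comp (mat_range (?D x))" for a
      proof -
        \<comment> \<open>The multiple of Du(x) that satisfies the constraint of
          \<open>normal_matrices\<close> for \<open>a\<close>; orthogonality of \<open>Q\<close> to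
          Du(x) then says that the trace term vanishes.\<close>
        define Q where "Q = (- trace_against a X / (?D x \<bullet> ?D x)) *\<^sub>R ?D x"
        have inner_Q: "?D x \<bullet> Q = - trace_against a X" using False by (simp add: Q_def)
        have "?D x \<bullet> Q = 0"
        proof (rule orth[OF x])
          fix t \<Omega>'
          assume \<Omega>': "open \<Omega>'" "\<Omega>' \<noteq> {}" "compactly_inside \<Omega>' \<Omega>" "x \<in> max_set \<Omega>' u"
          \<comment> \<open>The translation is chosen so that the affine map takes the value ta at
            x. The constraint is homogeneous in the pair (a, Q), so scaling both by t preserves
            it.\<close>
          let ?b = "t *\<^sub>R a - (t *\<^sub>R Q) *v x"
          let ?A = "\<lambda>y. (t *\<^sub>R Q) *v y + ?b"
          have J: "jacobian ?A (at y) = t *\<^sub>R Q" for y by (rule jacobian_affine) simp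
          have Ax: "?A x = t *\<^sub>R a" by simp
          have "?A x \<in> orthogonal_comp (mat_range (?D x))"
            unfolding Ax using a by (simp add: subspace_orthogonal_comp subspace_scale)
          moreover have "jacobian ?A (at y) \<in> normal_matrices (?D x) X (?A x)" for y
            unfolding Ax J using False inner_Q by (simp add: normal_matrices_def trace_against_eq)
          ultimately have "?A \<in> normal_affine_maps \<Omega> u rep \<Omega>'"
            unfolding normal_affine_maps_def
            using \<Omega>'(4) \<theta> X affine_mapI[of "t *\<^sub>R Q" ?b] by blast
          then show "Linf_norm \<Omega>' ?D \<le> Linf_norm \<Omega>' (\<lambda>y. ?D y + t *\<^sub>R Q)"
            using min \<Omega>' J by fastforce
        qed
        then show ?thesis using inner_Q by simp
      qed
      then show ?thesis using False by (simp add: normal_op_eq_0_iff)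
    qed
  qed
qed

end
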